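(* For every integer $k\geq1$ there is a constant $c_k>0$ depending only on $k$ such that $$\sup_{n\geq1}\left\|\nabla^k\Delta^{-k/p}\right\|_{L_p(\Omega_n)\to L_p(\Omega_n;\ell_2^{n^k})}\geq c_k(p-1)^{-k/2},\qquad 1<p\leq 2.$$
   Context: For $n\in\mathbb{N}=\{1,2,\dots\}$ let $[n]=\{1,\dots,n\}$ and let $\Omega_n=\{-1,1\}^n$ carry the uniform probability measure $\mu_n$; $L_p(\Omega_n)$ is the usual space of complex-valued functions with norm taken with respect to $\mu_n$. For $x\in\Omega_n$, $x^{(j)}$ is $x$ with $x_j$ replaced by $-x_j$, and $(D_jf)(x)=\frac{f(x)-f(x^{(j)})}{2}$. For $A\subseteq[n]$, $w_A(x)=\prod_{j\in A}x_j$ and $\widehat f(A)=\int_{\Omega_n} f\,w_A\,d\mu_n$. $\Delta=\sum_{j=1}^nD_j$, so that $\Delta w_A=|A|w_A$, and for $z\in\mathbb{C}$, $\Delta^zf=\sum_{\emptyset\neq A\subseteq[n]}|A|^z\widehat f(A)w_A$. For $\mathbf j=(j_1,\dots,j_k)\in[n]^k$ put $D_{\mathbf j}=D_{j_1}\cdots D_{j_k}$ and $\nabla^kf=\{D_{\mathbf j}f\}_{\mathbf j\in[n]^k}$. The norm of $h=(h_{\mathbf j})_{\mathbf j\in[n]^k}$ in $L_p(\Omega_n;\ell_2^{n^k})$ is $\|(\sum_{\mathbf j}|h_{\mathbf j}|^2)^{1/2}\|_{L_p(\Omega_n)}$. *)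

theory Defs
  imports "HOL-Probability.Probability"
begin

text \<open>Points of the cube are extensional functions on \<open>{1..n}\<close>. Functions on the cube are total
  functions of the ambient type; all norms and coefficients below only see their values on \<open>cube n\<close>.\<close>

definition cube :: "nat \<Rightarrow> (nat \<Rightarrow> real) set" where
  "cube n = {1..n} \<rightarrow>\<^sub>E {-1, 1}"

definition cube_measure :: "nat \<Rightarrow> (nat \<Rightarrow> real) measure" where
  "cube_measure n = uniform_count_measure (cube n)"

definition Lp_norm :: "nat \<Rightarrow> real \<Rightarrow> ((nat \<Rightarrow> real) \<Rightarrow> 'a::real_normed_vector) \<Rightarrow> real" where
  "Lp_norm n p f = (\<integral>x. norm (f x) powr p \<partial>cube_measure n) powr (1 / p)"

definition flip :: "nat \<Rightarrow> (nat \<Rightarrow> real) \<Rightarrow> (nat \<Rightarrow> real)" where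
  "flip j x = x(j := - x j)"

definition D :: "nat \<Rightarrow> ((nat \<Rightarrow> real) \<Rightarrow> complex) \<Rightarrow> (nat \<Rightarrow> real) \<Rightarrow> complex" where
  "D j f x = (f x - f (flip j x)) / 2"

definition walsh :: "nat set \<Rightarrow> (nat \<Rightarrow> real) \<Rightarrow> complex" where
  "walsh A x = (\<Prod>j\<in>A. complex_of_real (x j))"

definition fourier_coeff :: "nat \<Rightarrow> ((nat \<Rightarrow> real) \<Rightarrow> complex) \<Rightarrow> nat set \<Rightarrow> complex" where
  "fourier_coeff n f A = (\<integral>x. f x * walsh A x \<partial>cube_measure n)"

definition laplace_power ::
    "nat \<Rightarrow> complex \<Rightarrow> ((nat \<Rightarrow> real) \<Rightarrow> complex) \<Rightarrow> (nat \<Rightarrow> real) \<Rightarrow> complex" where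
  "laplace_power n z f x =
     (\<Sum>A\<in>Pow {1..n} - {{}}. of_nat (card A) powr z * fourier_coeff n f A * walsh A x)"

definition multi_indices :: "nat \<Rightarrow> nat \<Rightarrow> nat list set" where
  "multi_indices n k = {js. length js = k \<and> set js \<subseteq> {1..n}}"

definition nabla :: "((nat \<Rightarrow> real) \<Rightarrow> complex) \<Rightarrow> nat list \<Rightarrow> (nat \<Rightarrow> real) \<Rightarrow> complex" where
  "nabla f js = foldr D js f"

definition Lp_l2_norm ::
    "nat \<Rightarrow> nat \<Rightarrow> real \<Rightarrow> (nat list \<Rightarrow> (nat \<Rightarrow> real) \<Rightarrow> complex) \<Rightarrow> real" where
  "Lp_l2_norm n k p h = Lp_norm n p (\<lambda>x. L2_set (\<lambda>js. cmod (h js x)) (multi_indices n k))"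

text \<open>Taken in \<open>ennreal\<close>, so that suprema (over \<open>f\<close> here, over \<open>n\<close> in the theorem) need no
  boundedness side condition.\<close>

definition op_norm ::
    "nat \<Rightarrow> nat \<Rightarrow> real \<Rightarrow> (((nat \<Rightarrow> real) \<Rightarrow> complex) \<Rightarrow> nat list \<Rightarrow> (nat \<Rightarrow> real) \<Rightarrow> complex) \<Rightarrow> ennreal"
  where
  "op_norm n k p T = (SUP f\<in>{f. Lp_norm n p f \<le> 1}. ennreal (Lp_l2_norm n k p (T f)))"

end

theory Submission
  imports Defs
begin

text \<open>
  As \<open>p\<close> tends to \<open>1\<close> the bound is forced by a point mass on a cube of dimension about \<open>1 / (p - 1)\<close>.
  A multiple \<open>f\<close> of the indicator of one vertex with Fourier coefficients of modulus \<open>1\<close> has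
  \<open>L\<^sub>p\<close> norm \<open>2 powr (n (1 - 1 / p))\<close>, which remains bounded as long as \<open>n (p - 1)\<close> does.

  For the lower bound on the gradient, nothing has to be computed pointwise. Put
  \<open>g = \<Delta>\<^sup>z f\<close>, \<open>z = - k / p\<close>. If \<open>j\<^sub>1, \<dots>, j\<^sub>k\<close> are distinct with underlying set \<open>J\<close>, then
  \<open>D\<^sub>j\<close> preserves the Fourier coefficient at \<open>J\<close>, so the mean of \<open>|D\<^sub>j g|\<close> is at least the modulus of
  that coefficient, namely \<open>k powr (- k / p)\<close>. The \<open>L\<^sub>p\<close> norm dominates the \<open>L\<^sub>1\<close> norm, and by
  Cauchy--Schwarz the Euclidean norm of \<open>n\<^sup>k\<close> numbers is at least \<open>n powr (- k / 2)\<close> times the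
  sum of their moduli (lemma \<open>Lp_l2_norm_nabla_ge\<close>). For \<open>n \<ge> 2 k\<close> at least \<open>(n / 2)\<^sup>k\<close> of the
  multi-indices have distinct entries, and each contributes the same amount, so the norm of the
  gradient is at least a constant times
  \<open>n powr (- k / 2) * n\<^sup>k = n powr (k / 2)\<close>, which is comparable to \<open>(p - 1) powr (- k / 2)\<close>.
\<close>

section \<open>Averages over the cube\<close>

lemma finite_cube [simp]: "finite (cube n)"
  by (simp add: cube_def finite_PiE)

lemma card_cube: "card (cube n) = 2 ^ n"
proof -
  have "card {-1, 1 :: real} = 2"
    by (simp add: card_2_iff)
  then show ?thesis
    unfolding cube_def by (simp add: card_PiE del: card_insert_if card.insert)
qed

lemma integral_cube:
  fixes f :: "(nat \<Rightarrow> real) \<Rightarrow> 'a::{banach, second_countable_topology, real_normed_field}"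
  shows "(\<integral>x. f x \<partial>cube_measure n) = (\<Sum>x\<in>cube n. f x) / 2 ^ n"
  unfolding cube_measure_def uniform_count_measure_def
  by (simp add: lebesgue_integral_point_measure_finite card_cube scaleR_conv_of_real
      sum_divide_distrib)

lemma flip_flip [simp]: "flip j (flip j x) = x"
  by (simp add: flip_def fun_eq_iff)

lemma flip_in_cube: "j \<in> {1..n} \<Longrightarrow> x \<in> cube n \<Longrightarrow> flip j x \<in> cube n"
  unfolding cube_def flip_def by (auto simp: PiE_iff extensional_def)

lemma sum_cube_flip:
  assumes "j \<in> {1..n}"
  shows "(\<Sum>x\<in>cube n. F (flip j x)) = (\<Sum>x\<in>cube n. F x)"
  by (rule sum.reindex_bij_witness[where i = "flip j" and j = "flip j"])
    (use assms in \<open>auto intro: flip_in_cube\<close>)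

lemma Lp_norm_nonneg: "Lp_norm n p f \<ge> 0"
  by (simp add: Lp_norm_def)

lemma Lp_norm_cube:
  "Lp_norm n p f = ((\<Sum>x\<in>cube n. norm (f x) powr p) / 2 ^ n) powr (1 / p)"
  unfolding Lp_norm_def by (simp add: integral_cube)

text \<open>Monotonicity of \<open>L\<^sub>p\<close> norms on a probability space, between the exponents \<open>1\<close> and \<open>p\<close>.
  After rescaling to norm \<open>1\<close> it is Young's inequality against the constant \<open>1\<close>, averaged.\<close>

lemma mean_norm_le_Lp_norm:
  assumes "p > 1"
  shows "(\<Sum>x\<in>cube n. norm (f x)) / 2 ^ n \<le> Lp_norm n p f"
proof -
  define S where "S = (\<Sum>x\<in>cube n. norm (f x) powr p)"
  define N where "N = Lp_norm n p f"
  have S0: "S \<ge> 0"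
    unfolding S_def by (intro sum_nonneg) auto
  have Np: "N powr p = S / 2 ^ n"
    unfolding N_def Lp_norm_cube using assms S0 by (simp add: powr_powr flip: S_def)
  show ?thesis
  proof (cases "S = 0")
    case True
    then have "\<forall>x\<in>cube n. norm (f x) powr p = 0"
      unfolding S_def by (subst (asm) sum_nonneg_eq_0_iff) auto
    then have "(\<Sum>x\<in>cube n. norm (f x)) = 0"
      by (intro sum.neutral) auto
    then show ?thesis
      by (simp add: Lp_norm_nonneg)
  next
    case False
    then have N0: "N > 0"
      using Np S0 Lp_norm_nonneg[of n p f] assms unfolding N_def
      by (metis divide_eq_0_iff less_eq_real_def powr_zero_eq_one powr_eq_0_iff power_not_zero
          zero_neq_numeral)
    define q where "q = p / (p - 1)"
    have q: "q > 1" "1 / p + 1 / q = 1"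
      using assms by (simp_all add: q_def field_simps)
    have "(\<Sum>x\<in>cube n. norm (f x) / N) \<le> (\<Sum>x\<in>cube n. norm (f x) powr p / (N powr p * p) + 1 / q)"
    proof (rule sum_mono)
      fix x
      show "norm (f x) / N \<le> norm (f x) powr p / (N powr p * p) + 1 / q"
        using Youngs_inequality[of p q "norm (f x) / N" 1] assms q N0
        by (simp add: powr_divide)
    qed
    also have "\<dots> = S / (N powr p * p) + 2 ^ n / q"
      by (simp add: sum.distrib S_def card_cube flip: sum_divide_distrib)
    also have "\<dots> = 2 ^ n * (1 / p + 1 / q)"
      using False by (simp add: Np distrib_left)
    also have "\<dots> = 2 ^ n"
      by (simp add: q(2))
    finally have "(\<Sum>x\<in>cube n. norm (f x)) / N \<le> 2 ^ n"
      by (simp flip: sum_divide_distrib)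
    then show ?thesis
      using N0 by (simp add: field_simps flip: N_def)
  qed
qed

section \<open>Fourier coefficients\<close>

lemma walsh_flip:
  assumes "finite A"
  shows "walsh A (flip j x) = (if j \<in> A then - walsh A x else walsh A x)"
proof (cases "j \<in> A")
  case True
  have "(\<Prod>i\<in>A - {j}. complex_of_real (flip j x i)) = (\<Prod>i\<in>A - {j}. complex_of_real (x i))"
    by (rule prod.cong) (auto simp: flip_def)
  then show ?thesis
    using True assms by (simp add: walsh_def prod.remove[of A j] flip_def)
next
  case False
  have "(\<Prod>i\<in>A. complex_of_real (flip j x i)) = (\<Prod>i\<in>A. complex_of_real (x i))"
    by (rule prod.cong) (use False in \<open>auto simp: flip_def\<close>)
  then show ?thesis
    using False by (simp add: walsh_def)
qed

lemma cube_values: "x \<in> cube n \<Longrightarrow> i \<in> {1..n} \<Longrightarrow> x i = -1 \<or> x i = 1"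
  by (auto simp: cube_def PiE_iff)

lemma norm_walsh: "A \<subseteq> {1..n} \<Longrightarrow> x \<in> cube n \<Longrightarrow> cmod (walsh A x) = 1"
  unfolding walsh_def prod_norm[symmetric] by (rule prod.neutral) (auto dest!: cube_values)

lemma walsh_mult_self: "A \<subseteq> {1..n} \<Longrightarrow> x \<in> cube n \<Longrightarrow> walsh A x * walsh A x = 1"
  unfolding walsh_def prod.distrib[symmetric] by (rule prod.neutral) (auto dest!: cube_values)

lemma fourier_coeff_cube: "fourier_coeff n f A = (\<Sum>x\<in>cube n. f x * walsh A x) / 2 ^ n"
  unfolding fourier_coeff_def by (rule integral_cube)

lemma norm_fourier_coeff_le:
  assumes "A \<subseteq> {1..n}"
  shows "cmod (fourier_coeff n f A) \<le> (\<Sum>x\<in>cube n. cmod (f x)) / 2 ^ n"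
proof -
  have "cmod (\<Sum>x\<in>cube n. f x * walsh A x) \<le> (\<Sum>x\<in>cube n. cmod (f x * walsh A x))"
    by (rule norm_sum)
  also have "\<dots> = (\<Sum>x\<in>cube n. cmod (f x))"
    by (rule sum.cong) (simp_all add: norm_mult norm_walsh[OF assms])
  finally show ?thesis
    by (simp add: fourier_coeff_cube norm_divide norm_power divide_right_mono)
qed

text \<open>The flip preserves the measure and changes the sign of \<open>walsh A\<close>, so both halves of the
  difference quotient contribute equally.\<close>

lemma fourier_coeff_D:
  assumes "j \<in> A" "A \<subseteq> {1..n}"
  shows "fourier_coeff n (D j f) A = fourier_coeff n f A"
proof -
  have fin: "finite A"
    using assms(2) finite_subset by blast
  have "(\<Sum>x\<in>cube n. f (flip j x) * walsh A x)
      = (\<Sum>x\<in>cube n. f (flip j (flip j x)) * walsh A (flip j x))"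
    using assms by (intro sum_cube_flip[symmetric]) auto
  also have "\<dots> = - (\<Sum>x\<in>cube n. f x * walsh A x)"
    using assms fin by (simp add: walsh_flip sum_negf)
  finally have *: "(\<Sum>x\<in>cube n. f (flip j x) * walsh A x) = - (\<Sum>x\<in>cube n. f x * walsh A x)" .
  have "(\<Sum>x\<in>cube n. D j f x * walsh A x)
      = ((\<Sum>x\<in>cube n. f x * walsh A x) - (\<Sum>x\<in>cube n. f (flip j x) * walsh A x)) / 2"
    by (simp add: D_def left_diff_distrib sum_subtractf flip: sum_divide_distrib)
  also have "\<dots> = (\<Sum>x\<in>cube n. f x * walsh A x)"
    unfolding * by simp
  finally show ?thesis
    by (simp add: fourier_coeff_cube)
qed

lemma fourier_coeff_nabla:
  assumes "set js \<subseteq> A" "A \<subseteq> {1..n}"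
  shows "fourier_coeff n (nabla f js) A = fourier_coeff n f A"
  using assms(1) by (induction js) (simp_all add: nabla_def fourier_coeff_D[OF _ assms(2)])

text \<open>If \<open>j\<close> lies in \<open>A\<close> but not in \<open>B\<close>, then \<open>D j\<close> annihilates \<open>walsh B\<close> and yet preserves its
  coefficient at \<open>A\<close>, which is therefore \<open>0\<close>.\<close>

lemma walsh_orthonormal:
  assumes "A \<subseteq> {1..n}" "B \<subseteq> {1..n}"
  shows "fourier_coeff n (walsh B) A = (if A = B then 1 else 0)"
proof -
  have fin: "finite A" "finite B"
    using assms finite_subset by blast+
  have sep: "fourier_coeff n (walsh B) A = 0" if "A \<subseteq> {1..n}" "finite B" "j \<in> A" "j \<notin> B" for A B j
  proof -
    have "D j (walsh B) = (\<lambda>x. 0)"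
      using that by (simp add: D_def walsh_flip fun_eq_iff)
    then show ?thesis
      using fourier_coeff_D[of j A n "walsh B"] that by (simp add: fourier_coeff_cube)
  qed
  have sym: "fourier_coeff n (walsh B) A = fourier_coeff n (walsh A) B"
    by (simp add: fourier_coeff_cube mult.commute)
  show ?thesis
  proof (cases "A = B")
    case True
    then show ?thesis
      using assms by (simp add: fourier_coeff_cube walsh_mult_self card_cube)
  next
    case False
    then obtain j where "j \<in> A \<and> j \<notin> B \<or> j \<in> B \<and> j \<notin> A"
      by blast
    then show ?thesis
      using sep[of A B j] sep[of B A j] sym assms fin False by auto
  qed
qed

lemma fourier_coeff_laplace_power:
  assumes "A \<subseteq> {1..n}" "A \<noteq> {}"
  shows "fourier_coeff n (laplace_power n z f) A = of_nat (card A) powr z * fourier_coeff n f A"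
proof -
  let ?P = "Pow {1..n} - {{}}"
  let ?c = "\<lambda>B. of_nat (card B) powr z * fourier_coeff n f B"
  have "fourier_coeff n (laplace_power n z f) A
      = (\<Sum>B\<in>?P. ?c B * (\<Sum>x\<in>cube n. walsh B x * walsh A x)) / 2 ^ n"
    unfolding fourier_coeff_cube[of n "laplace_power n z f"] laplace_power_def
    by (subst sum_distrib_right, subst sum.swap) (simp add: sum_distrib_left mult.assoc)
  also have "\<dots> = (\<Sum>B\<in>?P. ?c B * fourier_coeff n (walsh B) A)"
    by (simp add: fourier_coeff_cube[of n "walsh _"] flip: sum_divide_distrib)
  also have "\<dots> = (\<Sum>B\<in>?P. if B = A then ?c B else 0)"
    by (rule sum.cong) (use assms in \<open>auto simp: walsh_orthonormal\<close>)
  also have "\<dots> = ?c A"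
    using assms by (subst sum.delta) auto
  finally show ?thesis .
qed

section \<open>The gradient norm dominates a sum of Fourier coefficients\<close>

lemma finite_multi_indices [simp]: "finite (multi_indices n k)"
  unfolding multi_indices_def
  using finite_lists_length_eq[of "{1..n}" k] by (simp add: conj_commute)

lemma card_multi_indices: "card (multi_indices n k) = n ^ k"
  unfolding multi_indices_def
  using card_lists_length_eq[of "{1..n}" k] by (simp add: conj_commute)

lemma card_distinct_multi_indices_ge:
  assumes "2 * k \<le> n"
  shows "(real n / 2) ^ k \<le> real (card {js \<in> multi_indices n k. distinct js})"
proof -
  have "{js \<in> multi_indices n k. distinct js}
      = {js. length js = k \<and> distinct js \<and> set js \<subseteq> {1..n}}"
    by (auto simp: multi_indices_def)
  then have "card {js \<in> multi_indices n k. distinct js} = \<Prod>{n - k + 1..n}"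
    using card_lists_distinct_length_eq[of "{1..n}" k] assms by simp
  moreover have "(real n / 2) ^ k = (\<Prod>i\<in>{n - k + 1..n}. real n / 2)"
    using assms by simp
  moreover have "\<dots> \<le> (\<Prod>i\<in>{n - k + 1..n}. real i)"
    using assms by (intro prod_mono) auto
  ultimately show ?thesis
    by simp
qed

lemma sum_le_sqrt_card_mult_L2_set:
  "(\<Sum>i\<in>I. \<bar>f i\<bar>) \<le> sqrt (card I) * L2_set f I"
  using L2_set_mult_ineq[of f "\<lambda>_. 1" I] by (simp add: L2_set_constant mult.commute)

text \<open>Passing to \<open>L\<^sub>1\<close> and to the sum over multi-indices decouples the components of the gradient.
  Multi-indices with repeated entries are discarded, so that each of the others tests a Walsh
  function of degree exactly \<open>k\<close>.\<close>

lemma Lp_l2_norm_nabla_ge: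
  assumes "p > 1" "n \<ge> 1"
  shows "(\<Sum>js | js \<in> multi_indices n k \<and> distinct js. cmod (fourier_coeff n g (set js)))
    \<le> sqrt (real n ^ k) * Lp_l2_norm n k p (nabla g)"
proof -
  let ?M = "multi_indices n k"
  let ?G = "\<lambda>x. L2_set (\<lambda>js. cmod (nabla g js x)) ?M"
  have "(\<Sum>js | js \<in> ?M \<and> distinct js. cmod (fourier_coeff n g (set js)))
      \<le> (\<Sum>js\<in>?M. cmod (fourier_coeff n g (set js)))"
    by (rule sum_mono2) auto
  also have "\<dots> \<le> (\<Sum>js\<in>?M. (\<Sum>x\<in>cube n. cmod (nabla g js x)) / 2 ^ n)"
  proof (rule sum_mono)
    fix js assume "js \<in> ?M"
    then have "set js \<subseteq> {1..n}"
      by (simp add: multi_indices_def)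
    then show "cmod (fourier_coeff n g (set js)) \<le> (\<Sum>x\<in>cube n. cmod (nabla g js x)) / 2 ^ n"
      using norm_fourier_coeff_le[of "set js" n "nabla g js"] by (simp add: fourier_coeff_nabla)
  qed
  also have "\<dots> = (\<Sum>x\<in>cube n. \<Sum>js\<in>?M. cmod (nabla g js x)) / 2 ^ n"
    by (subst sum.swap) (simp add: sum_divide_distrib)
  also have "\<dots> \<le> (\<Sum>x\<in>cube n. sqrt (real n ^ k) * ?G x) / 2 ^ n"
  proof (intro divide_right_mono sum_mono)
    fix x
    show "(\<Sum>js\<in>?M. cmod (nabla g js x)) \<le> sqrt (real n ^ k) * ?G x"
      using sum_le_sqrt_card_mult_L2_set[of "\<lambda>js. cmod (nabla g js x)" ?M]
      by (simp add: card_multi_indices)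
  qed simp
  also have "\<dots> = sqrt (real n ^ k) * ((\<Sum>x\<in>cube n. norm (?G x)) / 2 ^ n)"
    by (simp add: sum_distrib_left L2_set_nonneg)
  also have "\<dots> \<le> sqrt (real n ^ k) * Lp_l2_norm n k p (nabla g)"
    unfolding Lp_l2_norm_def by (intro mult_left_mono mean_norm_le_Lp_norm assms) simp
  finally show ?thesis .
qed

section \<open>Point masses\<close>

definition spike :: "nat \<Rightarrow> real \<Rightarrow> (nat \<Rightarrow> real) \<Rightarrow> complex" where
  "spike n c x = (if x = (\<lambda>j\<in>{1..n}. 1) then of_real c else 0)"

lemma ones_in_cube: "(\<lambda>j\<in>{1..n}. 1) \<in> cube n"
  by (auto simp: cube_def)

lemma fourier_coeff_spike:
  assumes "A \<subseteq> {1..n}"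
  shows "fourier_coeff n (spike n c) A = of_real (c / 2 ^ n)"
proof -
  have "walsh A (\<lambda>j\<in>{1..n}. 1) = 1"
    unfolding walsh_def by (rule prod.neutral) (use assms in auto)
  moreover have "(\<Sum>x\<in>cube n. spike n c x * walsh A x)
      = (\<Sum>x\<in>cube n. if x = (\<lambda>j\<in>{1..n}. 1) then of_real c * walsh A x else 0)"
    by (rule sum.cong) (auto simp: spike_def)
  ultimately show ?thesis
    using ones_in_cube[of n] by (simp add: fourier_coeff_cube)
qed

lemma Lp_norm_spike:
  assumes "p > 0" "c \<ge> 0"
  shows "Lp_norm n p (spike n c) = c * 2 powr (- real n / p)"
proof -
  have "(\<Sum>x\<in>cube n. norm (spike n c x) powr p)
      = (\<Sum>x\<in>cube n. if x = (\<lambda>j\<in>{1..n}. 1) then c powr p else 0)"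
    by (rule sum.cong) (use assms in \<open>auto simp: spike_def\<close>)
  also have "\<dots> = c powr p"
    using ones_in_cube[of n] by simp
  finally have "Lp_norm n p (spike n c) = (c powr p * 2 powr (- real n)) powr (1 / p)"
    by (simp add: Lp_norm_cube powr_minus_divide powr_realpow)
  then show ?thesis
    using assms by (simp add: powr_mult powr_powr)
qed

section \<open>Blow-up of the operator norm\<close>

theorem proposition7p1:
  fixes k :: nat
  assumes "k \<ge> 1"
  shows "\<exists>c::real. c > 0 \<and>
    (\<forall>p::real. 1 < p \<and> p \<le> 2 \<longrightarrow>
      (SUP n\<in>{1..}. op_norm n k p
         (\<lambda>f. nabla (laplace_power n (complex_of_real (- real k / p)) f)))
      \<ge> ennreal (c * (p - 1) powr (- real k / 2)))"
proof (intro exI conjI allI impI)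
  let ?c = "1 / (2 ^ (5 * k) * real k ^ k)"
  show "?c > 0"
    using assms by simp
  fix p :: real
  assume p: "1 < p \<and> p \<le> 2"
  \<comment> \<open>The factor \<open>2 * k\<close> leaves room for \<open>k\<close> distinct indices, and the ceiling makes \<open>n * (p - 1)\<close>
    lie between \<open>2 * k\<close> and \<open>4 * k\<close>.\<close>
  define m where "m = nat \<lceil>1 / (p - 1)\<rceil>"
  define n where "n = 2 * k * m"
  have m_lower: "1 / (p - 1) \<le> real m"
    unfolding m_def by (rule real_nat_ceiling_ge)
  have m_upper: "real m \<le> 1 / (p - 1) + 1"
  proof -
    have "0 \<le> 1 / (p - 1)"
      using p by simp
    then show ?thesis
      unfolding m_def by linarith
  qed
  have "0 < 1 / (p - 1)"
    using p by simp
  then have m1: "m \<ge> 1"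
    using m_lower by linarith
  then have n2k: "2 * k \<le> n" and n1: "n \<ge> 1" and "m \<le> n"
    using assms by (simp_all add: n_def)
  have n_lower: "1 / (p - 1) \<le> real n"
    using m_lower \<open>m \<le> n\<close> by linarith
  have n_upper: "real n * (p - 1) \<le> 4 * real k"
  proof -
    have "real m * (p - 1) \<le> (1 / (p - 1) + 1) * (p - 1)"
      using m_upper p by (intro mult_right_mono) auto
    also have "\<dots> = p"
      using p by (simp add: field_simps)
    finally have "real m * (p - 1) \<le> 2"
      using p by linarith
    then have "2 * real k * (real m * (p - 1)) \<le> 2 * real k * 2"
      by (intro mult_left_mono) auto
    then show ?thesis
      by (simp add: n_def mult.assoc)
  qed
  \<comment> \<open>The height \<open>2 ^ n\<close> would make all Fourier coefficients \<open>1\<close> and the norm at most \<open>2 ^ (4 * k)\<close>;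
    dividing by the latter brings \<open>f\<close> into the unit ball.\<close>
  define h where "h = (2 ^ n / 2 ^ (4 * k) :: real)"
  define f where "f = spike n h"
  define z where "z = complex_of_real (- real k / p)"
  have "Lp_norm n p f \<le> 1"
  proof -
    have "h = 2 powr (real n - real (4 * k))"
      unfolding h_def powr_diff by (simp only: powr_realpow zero_less_numeral)
    then have "Lp_norm n p f = 2 powr (real n - 4 * real k - real n / p)"
      using p by (simp add: f_def Lp_norm_spike flip: powr_add)
    moreover have "real n - 4 * real k - real n / p \<le> 0"
    proof -
      have "real n - real n / p = real n * (p - 1) / p"
        using p by (simp add: field_simps)
      also have "\<dots> \<le> real n * (p - 1) / 1"
        using p by (intro divide_left_mono) auto
      finally show ?thesis
        using n_upper by simp
    qed
    ultimately show ?thesis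
      using powr_mono[of "real n - 4 * real k - real n / p" 0 2] by simp
  qed
  then have op: "op_norm n k p (\<lambda>f. nabla (laplace_power n z f))
      \<ge> ennreal (Lp_l2_norm n k p (nabla (laplace_power n z f)))"
    unfolding op_norm_def by (intro SUP_upper) simp
  have coeff: "1 / (2 ^ (4 * k) * real k ^ k) \<le> cmod (fourier_coeff n (laplace_power n z f) (set js))"
    if "js \<in> multi_indices n k" "distinct js" for js
  proof -
    have js: "set js \<subseteq> {1..n}" "set js \<noteq> {}" "card (set js) = k"
      using that assms by (auto simp: multi_indices_def distinct_card)
    have "real k powr (- real k) \<le> real k powr (- real k / p)"
      using assms p by (intro powr_mono) (auto simp: field_simps)
    moreover have "real k powr (- real k) = 1 / real k ^ k"
      using assms by (simp add: powr_minus_divide powr_realpow)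
    ultimately have "1 / real k ^ k * (1 / 2 ^ (4 * k)) \<le> real k powr (- real k / p) * (1 / 2 ^ (4 * k))"
      by (intro mult_right_mono) auto
    also have "\<dots> = cmod (fourier_coeff n (laplace_power n z f) (set js))"
      using js by (simp add: fourier_coeff_laplace_power f_def fourier_coeff_spike norm_mult
          norm_powr_real_powr z_def h_def norm_divide norm_power)
    finally show ?thesis
      by (simp add: mult.commute)
  qed
  let ?s = "sqrt (real n ^ k)"
  have s0: "?s > 0"
    using n1 by simp
  have "(real n / 2) ^ k * (1 / (2 ^ (4 * k) * real k ^ k))
      \<le> (\<Sum>js | js \<in> multi_indices n k \<and> distinct js. 1 / (2 ^ (4 * k) * real k ^ k))"
    unfolding sum_constant using card_distinct_multi_indices_ge[OF n2k]
    by (intro mult_right_mono) auto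
  also have "\<dots> \<le> (\<Sum>js | js \<in> multi_indices n k \<and> distinct js.
      cmod (fourier_coeff n (laplace_power n z f) (set js)))"
    by (rule sum_mono) (use coeff in auto)
  also have "\<dots> \<le> ?s * Lp_l2_norm n k p (nabla (laplace_power n z f))"
    using p n1 by (intro Lp_l2_norm_nabla_ge) auto
  also have "(real n / 2) ^ k * (1 / (2 ^ (4 * k) * real k ^ k)) = ?s * (?s * ?c)"
  proof -
    have "(2::real) ^ (5 * k) = 2 ^ k * 2 ^ (4 * k)"
      by (simp flip: power_add)
    moreover have "?s * ?s = real n ^ k"
      by simp
    ultimately show ?thesis
      by (simp add: power_divide flip: mult.assoc)
  qed
  finally have "?s * ?c \<le> Lp_l2_norm n k p (nabla (laplace_power n z f))"
    using s0 by (simp only: mult_le_cancel_left_pos)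
  moreover have "(p - 1) powr (- real k / 2) \<le> ?s"
  proof -
    have "(p - 1) powr (- real k / 2) = (1 / (p - 1)) powr (real k / 2)"
      using p by (simp add: powr_minus_divide powr_divide)
    also have "\<dots> \<le> real n powr (real k / 2)"
      using p n_lower by (intro powr_mono2) auto
    also have "\<dots> = ?s"
      using n1 by (simp add: powr_half_sqrt[symmetric] powr_powr powr_realpow[symmetric])
    finally show ?thesis .
  qed
  then have "?c * (p - 1) powr (- real k / 2) \<le> ?s * ?c"
    by (subst mult.commute) (intro mult_right_mono, auto)
  ultimately have "ennreal (?c * (p - 1) powr (- real k / 2))
      \<le> ennreal (Lp_l2_norm n k p (nabla (laplace_power n z f)))"
    by (intro ennreal_leI) linarith
  also note op
  also have "op_norm n k p (\<lambda>f. nabla (laplace_power n z f))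
      \<le> (SUP n\<in>{1..}. op_norm n k p (\<lambda>f. nabla (laplace_power n z f)))"
    using n1 by (intro SUP_upper) simp
  finally show "ennreal (?c * (p - 1) powr (- real k / 2))
      \<le> (SUP n\<in>{1..}. op_norm n k p
           (\<lambda>f. nabla (laplace_power n (complex_of_real (- real k / p)) f)))"
    by (simp add: z_def)
qed

end
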